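(* Consider the system of 3 point vortices in the plane with vorticities $\Gamma_1=1$, $\Gamma_2=1$, $\Gamma_3=-2$, with phase space $M$, symmetry group $G=\mathrm{SE}(2)$, momentum map $\Phi=(\Phi_{\mathbb{C}},\Phi_{\mathbb{R}}):M\to\mathfrak{g}^*\simeq\mathbb{C}\times\mathbb{R}$ and Hamiltonian $h$. Let $\gamma$ be a collinear relative equilibrium for $h$, i.e. a relative equilibrium with $\Phi_{\mathbb{C}}(\gamma)=0$ (in which case $z_1,z_2,z_3$ are collinear with $z_3$ midway between $z_1$ and $z_2$). Let $$U=\{z\in M : e^{2\pi h(z)} > e^{2\pi h(\gamma)}/3\},$$ a $G$-invariant neighbourhood of $\gamma$ in $M$, and let $V = (D\times\mathbb{R})\setminus(\{0\}\times\mathbb{R}^+)$, a punctured neighbourhood of $\mu = \Phi(\gamma)$ in $\mathfrak{g}^{*}$, where $D\subset \mathbb{C}$ is the open disc of radius $(\sqrt{3}\, e^{2\pi h(\gamma)})^{1/3}$ centred at $0$. Then $\gamma$ is extremal, but $\Phi^{-1}(V)\cap U$ contains no relative equilibrium for $h$.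
   Context: The phase space is $M=\{(z_1,z_2,z_3)\in\mathbb{C}^3: z_k\neq z_l \text{ for } k\ne l\}$ with symplectic form $\omega=\frac{i}{2}\sum_{k=1}^3\Gamma_k\,dz_k\wedge d\overline{z}_k$. The Euclidean group $G=\mathrm{SE}(2)=\mathbb{R}^2\rtimes\mathrm{SO}(2)$ acts diagonally on $M$, with momentum map, under $\mathfrak{g}^*\simeq\mathbb{C}\times\mathbb{R}$, $$\Phi=(\Phi_{\mathbb{C}},\Phi_{\mathbb{R}}):(z_1,z_2,z_3)\mapsto\Big(i\sum_{k=1}^3\Gamma_kz_k,\ \sum_{k=1}^3\Gamma_k\frac{|z_k|^2}{2}\Big),$$ which is equivariant for the standard coadjoint action since $\sum_k\Gamma_k=0$. The $G$-invariant Hamiltonian is $$h(z_1,z_2,z_3)=-\frac{1}{2\pi}\sum_{k<l}\Gamma_k\Gamma_l\log|z_k-z_l|,$$ and Hamilton's equations read $\dfrac{dz_k}{dt}=-\dfrac{1}{2\pi i}\displaystyle\sum_{l\neq k}\frac{\Gamma_l}{\overline{z}_k-\overline{z}_l}$ for $k=1,2,3$. A relative equilibrium is a trajectory whose image in $M/G$ is a single point; $h(\gamma)$ and $\Phi(\gamma)$ denote the (constant) values of $h$ and $\Phi$ along it. A relative equilibrium with momentum value $\mu$ is extremal if its image in the reduced space $\Phi^{-1}(\mu)/G_\mu$ is a local extremum of the function induced by $h$, where $G_\mu$ is the coadjoint isotropy subgroup of $\mu$. $\mathbb{R}^+$ denotes the positive reals. *)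

theory Defs
  imports "HOL-Analysis.Analysis"
begin

section \<open>Three point vortices in the plane\<close>

definition phase_space :: "(complex^3) set" where
  "phase_space = {z. \<forall>k l. k \<noteq> l \<longrightarrow> z $ k \<noteq> z $ l}"

definition hamiltonian :: "real^3 \<Rightarrow> complex^3 \<Rightarrow> real" where
  "hamiltonian \<Gamma> z =
     - (1 / (2 * pi)) * (\<Sum>(k, l)\<in>{(1, 2), (1, 3), (2, 3)}. \<Gamma> $ k * \<Gamma> $ l * ln (norm (z $ k - z $ l)))"

text \<open>The right-hand side of Hamilton's equations for the symplectic form
  \<open>(i/2) \<Sum>k. \<Gamma>k dzk \<and> d(cnj zk)\<close>.\<close>

definition vortex_field :: "real^3 \<Rightarrow> complex^3 \<Rightarrow> complex^3" where
  "vortex_field \<Gamma> z =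
     (\<chi> k. - (1 / (2 * pi * \<i>)) * (\<Sum>l\<in>UNIV - {k}. \<Gamma> $ l / (cnj (z $ k) - cnj (z $ l))))"

definition momentum :: "real^3 \<Rightarrow> complex^3 \<Rightarrow> complex \<times> real" where
  "momentum \<Gamma> z = (\<i> * (\<Sum>k\<in>UNIV. \<Gamma> $ k * z $ k), \<Sum>k\<in>UNIV. \<Gamma> $ k * ((norm (z $ k))\<^sup>2 / 2))"

definition trajectory :: "real^3 \<Rightarrow> (real \<Rightarrow> complex^3) \<Rightarrow> real set \<Rightarrow> bool" where
  "trajectory \<Gamma> \<gamma> I \<longleftrightarrow> open I \<and> is_interval I \<and> I \<noteq> {} \<and>
     (\<forall>t\<in>I. \<gamma> t \<in> phase_space \<and> (\<gamma> has_vector_derivative vortex_field \<Gamma> (\<gamma> t)) (at t))"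

section \<open>The Euclidean group and its coadjoint action\<close>

text \<open>The pair \<open>(b, u)\<close> with \<open>norm u = 1\<close> is the motion \<open>w \<mapsto> u * w + b\<close> of the plane.\<close>

definition SE2 :: "(complex \<times> complex) set" where
  "SE2 = UNIV \<times> sphere 0 1"

definition se2_inv :: "complex \<times> complex \<Rightarrow> complex \<times> complex" where
  "se2_inv = (\<lambda>(b, u). (- (b / u), 1 / u))"

definition act :: "complex \<times> complex \<Rightarrow> complex^3 \<Rightarrow> complex^3" where
  "act = (\<lambda>(b, u) z. \<chi> k. u * z $ k + b)"

text \<open>The pair \<open>(v, \<alpha>)\<close> of the Lie algebra is the infinitesimal motion \<open>w \<mapsto> v + \<i> * \<alpha> * w\<close>;
  the adjoint action of \<open>(b, u)\<close> conjugates it to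
  \<open>w \<mapsto> u * (v + \<i> * \<alpha> * ((w - b) / u)) = (u * v - \<i> * \<alpha> * b) + \<i> * \<alpha> * w\<close>.
  The dual of the Lie algebra is identified with \<open>complex \<times> real\<close> through the Euclidean
  inner product. For this identification \<open>momentum \<Gamma>\<close> is a momentum map (up to the sign
  convention for Hamiltonian vector fields).\<close>

definition Ad :: "complex \<times> complex \<Rightarrow> complex \<times> real \<Rightarrow> complex \<times> real" where
  "Ad = (\<lambda>(b, u) (v, \<alpha>). (u * v - \<i> * \<alpha> * b, \<alpha>))"

definition coAd :: "complex \<times> complex \<Rightarrow> complex \<times> real \<Rightarrow> complex \<times> real" where
  "coAd g = adjoint (Ad (se2_inv g))"

definition isotropy :: "complex \<times> real \<Rightarrow> (complex \<times> complex) set" where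
  "isotropy \<mu> = {g \<in> SE2. coAd g \<mu> = \<mu>}"

lemma coAd_eq:
  assumes "(b, u) \<in> SE2"
  shows "coAd (b, u) (m, r) = (u * m, r + Im (cnj b * u * m))"
proof -
  have n: "norm u = 1" using assms by (simp add: SE2_def)
  then have u0: "u \<noteq> 0" by auto
  have "u * cnj u = 1" using n by (simp add: complex_norm_square[symmetric])
  then have inv: "1 / u = cnj u" using u0 by (simp add: field_simps)
  have "adjoint (Ad (se2_inv (b, u))) = (\<lambda>(m, r). (u * m, r + Im (cnj b * u * m)))"
  proof (rule adjoint_unique, intro allI)
    fix x y :: "complex \<times> real"
    obtain v a where x: "x = (v, a)" by fastforce
    obtain m r where y: "y = (m, r)" by fastforce
    have "b / u = b * cnj u" using inv by (metis times_divide_eq_right mult.right_neutral)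
    then show "Ad (se2_inv (b, u)) x \<bullet> y = x \<bullet> (case y of (m, r) \<Rightarrow> (u * m, r + Im (cnj b * u * m)))"
      by (simp add: x y Ad_def se2_inv_def inv inner_complex_def algebra_simps)
  qed
  then show ?thesis by (simp add: coAd_def)
qed

lemma momentum_equivariant:
  assumes "g \<in> SE2" and "(\<Sum>k\<in>UNIV. \<Gamma> $ k) = 0"
  shows "momentum \<Gamma> (act g z) = coAd g (momentum \<Gamma> z)"
proof -
  obtain b u where g: "g = (b, u)" by fastforce
  define c where "c = cnj b * u"
  define S where "S = (\<Sum>k\<in>UNIV. \<Gamma> $ k * z $ k)"
  have n: "norm u = 1" using assms by (simp add: SE2_def g)
  have "(\<Sum>k\<in>UNIV. complex_of_real (\<Gamma> $ k)) = 0"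
    using assms(2) by (metis of_real_0 of_real_sum)
  then have "(\<Sum>k\<in>UNIV. \<Gamma> $ k * (u * z $ k + b)) = u * S"
    by (simp add: S_def distrib_left sum.distrib sum_distrib_left sum_distrib_right[symmetric] mult.left_commute)
  then have 1: "fst (momentum \<Gamma> (act g z)) = u * (\<i> * S)"
    by (simp add: momentum_def act_def g mult.left_commute)
  have sq: "(norm (u * w + b))\<^sup>2 / 2 = (norm w)\<^sup>2 / 2 + Re (c * w) + (norm b)\<^sup>2 / 2" for w
  proof -
    have "(norm (x + b))\<^sup>2 = (norm x)\<^sup>2 + 2 * Re (cnj b * x) + (norm b)\<^sup>2" for x
      unfolding cmod_power2 by (simp add: power2_eq_square algebra_simps)
    from this[of "u * w"] show ?thesis using n by (simp add: norm_mult c_def algebra_simps)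
  qed
  have "(\<Sum>k\<in>UNIV. \<Gamma> $ k * Re (c * z $ k)) = Re (c * S)"
    by (simp add: S_def sum_distrib_left algebra_simps sum.distrib sum_subtractf)
  then have "snd (momentum \<Gamma> (act g z)) = snd (momentum \<Gamma> z) + Re (c * S)"
    using assms(2)
    by (simp only: momentum_def act_def g snd_conv case_prod_conv vec_lambda_beta sq
        distrib_left sum.distrib sum_distrib_right[symmetric])
  then have 2: "snd (momentum \<Gamma> (act g z)) = snd (momentum \<Gamma> z) + Im (c * (\<i> * S))"
    by (simp add: mult.left_commute)
  have "momentum \<Gamma> z = (\<i> * S, snd (momentum \<Gamma> z))"
    by (simp add: momentum_def S_def)
  then have "coAd g (momentum \<Gamma> z) = (u * (\<i> * S), snd (momentum \<Gamma> z) + Im (c * (\<i> * S)))"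
    using coAd_eq[of b u "\<i> * S" "snd (momentum \<Gamma> z)"] assms(1) by (simp only: g c_def)
  then show ?thesis using 1 2 by (simp add: prod_eq_iff)
qed

section \<open>Orbit spaces and relative equilibria\<close>

definition orb :: "(complex \<times> complex) set \<Rightarrow> complex^3 \<Rightarrow> (complex^3) set" where
  "orb H z = (\<lambda>g. act g z) ` H"

text \<open>The quotient topology on the orbit space \<open>orb H ` X\<close>.\<close>

definition orbit_topology ::
  "(complex \<times> complex) set \<Rightarrow> (complex^3) set \<Rightarrow> (complex^3) set topology" where
  "orbit_topology H X =
     topology (\<lambda>W. W \<subseteq> orb H ` X \<and> openin (top_of_set X) {x \<in> X. orb H x \<in> W})"

lemma openin_orbit_topology:
  "openin (orbit_topology H X) W \<longleftrightarrow>
     W \<subseteq> orb H ` X \<and> openin (top_of_set X) {x \<in> X. orb H x \<in> W}"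
proof -
  have "istopology (\<lambda>W. W \<subseteq> orb H ` X \<and> openin (top_of_set X) {x \<in> X. orb H x \<in> W})"
    unfolding istopology_def
  proof (intro conjI allI impI)
    fix S T
    assume S: "S \<subseteq> orb H ` X \<and> openin (top_of_set X) {x \<in> X. orb H x \<in> S}"
      and T: "T \<subseteq> orb H ` X \<and> openin (top_of_set X) {x \<in> X. orb H x \<in> T}"
    have "{x \<in> X. orb H x \<in> S \<inter> T} = {x \<in> X. orb H x \<in> S} \<inter> {x \<in> X. orb H x \<in> T}" by auto
    then show "openin (top_of_set X) {x \<in> X. orb H x \<in> S \<inter> T}"
      using openin_Int[of "top_of_set X"] S T by simp
    show "S \<inter> T \<subseteq> orb H ` X" using S by auto
  next
    fix K
    assume K: "\<forall>S\<in>K. S \<subseteq> orb H ` X \<and> openin (top_of_set X) {x \<in> X. orb H x \<in> S}"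
    have "{x \<in> X. orb H x \<in> \<Union> K} = (\<Union>S\<in>K. {x \<in> X. orb H x \<in> S})" by auto
    moreover have "openin (top_of_set X) (\<Union>S\<in>K. {x \<in> X. orb H x \<in> S})"
      using K by (intro openin_Union) auto
    ultimately show "openin (top_of_set X) {x \<in> X. orb H x \<in> \<Union> K}" by simp
    show "\<Union> K \<subseteq> orb H ` X" using K by blast
  qed
  then show ?thesis by (simp add: orbit_topology_def topology_inverse')
qed

lemma topspace_orbit_topology: "topspace (orbit_topology H X) = orb H ` X"
proof -
  have "{x \<in> X. orb H x \<in> orb H ` X} = X" by auto
  then have "openin (orbit_topology H X) (orb H ` X)"
    by (simp add: openin_orbit_topology)
  moreover have "topspace (orbit_topology H X) \<subseteq> orb H ` X"
    using openin_topspace[of "orbit_topology H X"] unfolding openin_orbit_topology by (rule conjunct1)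
  ultimately show ?thesis by (simp add: openin_subset subset_antisym)
qed

lemma quotient_map_orb: "quotient_map (top_of_set X) (orbit_topology H X) (orb H)"
  unfolding quotient_map_def topspace_orbit_topology openin_orbit_topology by simp

definition relative_equilibrium :: "real^3 \<Rightarrow> (real \<Rightarrow> complex^3) \<Rightarrow> real set \<Rightarrow> bool" where
  "relative_equilibrium \<Gamma> \<gamma> I \<longleftrightarrow>
     trajectory \<Gamma> \<gamma> I \<and> (\<exists>p. (\<lambda>t. orb SE2 (\<gamma> t)) ` I = {p})"

text \<open>The value of a quantity that is constant along the curve.\<close>

definition const_value :: "('a \<Rightarrow> 'b) \<Rightarrow> (real \<Rightarrow> 'a) \<Rightarrow> real set \<Rightarrow> 'b" where
  "const_value f \<gamma> I = the_elem ((\<lambda>t. f (\<gamma> t)) ` I)"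

definition local_extremum :: "'a topology \<Rightarrow> ('a \<Rightarrow> real) \<Rightarrow> 'a \<Rightarrow> bool" where
  "local_extremum T f p \<longleftrightarrow> p \<in> topspace T \<and>
     (\<exists>W. openin T W \<and> p \<in> W \<and> ((\<forall>q\<in>W. f q \<le> f p) \<or> (\<forall>q\<in>W. f p \<le> f q)))"

definition level_set :: "real^3 \<Rightarrow> complex \<times> real \<Rightarrow> (complex^3) set" where
  "level_set \<Gamma> \<mu> = {z \<in> phase_space. momentum \<Gamma> z = \<mu>}"

text \<open>The function induced by the (invariant) Hamiltonian on orbits.\<close>

definition induced_hamiltonian :: "real^3 \<Rightarrow> (complex^3) set \<Rightarrow> real" where
  "induced_hamiltonian \<Gamma> p = the_elem (hamiltonian \<Gamma> ` p)"

definition extremal :: "real^3 \<Rightarrow> (real \<Rightarrow> complex^3) \<Rightarrow> real set \<Rightarrow> bool" where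
  "extremal \<Gamma> \<gamma> I \<longleftrightarrow>
     (let \<mu> = const_value (momentum \<Gamma>) \<gamma> I in
      \<exists>p. (\<lambda>t. orb (isotropy \<mu>) (\<gamma> t)) ` I = {p} \<and>
          local_extremum (orbit_topology (isotropy \<mu>) (level_set \<Gamma> \<mu>)) (induced_hamiltonian \<Gamma>) p)"

end

theory Submission
  imports Defs
begin

text \<open>
  Put \<open>a = z1 - z3\<close> and \<open>b = z2 - z3\<close>. For vorticities \<open>1, 1, -2\<close> the linear momentum is
  \<open>\<Phi>\<^sub>C = \<i> * (a + b)\<close>, and \<open>exp (2 * pi * h) = \<bar>a\<bar>\<^sup>2 * \<bar>b\<bar>\<^sup>2 / \<bar>a - b\<bar>\<close>.
  The cases \<open>\<Phi>\<^sub>C = 0\<close> and \<open>\<Phi>\<^sub>C \<noteq> 0\<close> differ because only in the second one does a rotation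
  change the momentum.

  If \<open>\<Phi>\<^sub>C = 0\<close>, then \<open>b = - a\<close>, so the third vortex is the midpoint of the other two, and the
  angular momentum is \<open>\<bar>a\<bar>\<^sup>2\<close>. It is positive, and it determines the configuration
  up to a rigid motion. The isotropy group of \<open>(0, r)\<close> is all of \<open>SE(2)\<close>, hence the
  reduced space is a single point (\<open>collinear_orbit_eq_level_set\<close>), on which every
  function is extremal (\<open>collinear_extremal\<close>).

  If \<open>\<Phi>\<^sub>C \<noteq> 0\<close>, a rigid motion \<open>w \<mapsto> u * w + c\<close> acts on \<open>\<Phi>\<^sub>C\<close> as multiplication by \<open>u\<close>.
  Since the momentum is conserved (\<open>momentum_conserved\<close>), the motions that relate two points of a
  relative equilibrium have \<open>u = 1\<close>: the configuration is only translated, so the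
  vortices have equal velocities (\<open>translating_relative_equilibrium\<close>). Equality of the first two
  velocities forces \<open>a\<^sup>2 - a * b + b\<^sup>2 = 0\<close>, that is, an equilateral triangle
  (\<open>equal_velocities_imp_equilateral\<close>). With side \<open>s\<close> one gets
  \<open>exp (2 * pi * h) = s ^ 3\<close> and \<open>\<bar>\<Phi>\<^sub>C\<bar> = sqrt 3 * s\<close>, thus
  \<open>\<bar>\<Phi>\<^sub>C\<bar> ^ 3 = 3 * sqrt 3 * exp (2 * pi * h)\<close> (\<open>equilateral_norm_momentum\<close>). The bounds
  \<open>exp (2 * pi * h) > E / 3\<close> and \<open>\<bar>\<Phi>\<^sub>C\<bar> ^ 3 < sqrt 3 * E\<close> are therefore incompatible.
  On the other hand \<open>\<Phi>\<^sub>C = 0\<close> forces a positive angular momentum, and the half line of these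
  values is exactly what is removed from \<open>D \<times> \<real>\<close>.
\<close>

section \<open>The symmetry group and relative equilibria\<close>

lemma act_component: "act (b, u) z $ k = u * z $ k + b"
  by (simp add: act_def)

lemma norm_diff_act:
  assumes "g \<in> SE2"
  shows "norm (act g z $ k - act g z $ l) = norm (z $ k - z $ l)"
proof -
  obtain b u where g: "g = (b, u)" by fastforce
  have "act g z $ k - act g z $ l = u * (z $ k - z $ l)"
    by (simp add: g act_component algebra_simps)
  then show ?thesis using assms by (simp add: norm_mult SE2_def g)
qed

lemma act_phase_space:
  assumes "g \<in> SE2" and "z \<in> phase_space"
  shows "act g z \<in> phase_space"
proof -
  have "act g z $ k \<noteq> act g z $ l" if "k \<noteq> l" for k l
    using norm_diff_act[OF assms(1), of z k l] assms(2) that by (auto simp: phase_space_def)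
  then show ?thesis by (simp add: phase_space_def)
qed

lemma hamiltonian_act:
  assumes "g \<in> SE2"
  shows "hamiltonian \<Gamma> (act g z) = hamiltonian \<Gamma> z"
  unfolding hamiltonian_def norm_diff_act[OF assms] ..

lemma mem_orb_SE2: "z \<in> orb SE2 z"
proof -
  have "act (0, 1) z = z" by (simp add: act_def vec_eq_iff)
  moreover have "(0, 1) \<in> SE2" by (simp add: SE2_def)
  ultimately show ?thesis unfolding orb_def by (metis imageI)
qed

lemma relative_equilibrium_imp_act:
  assumes "relative_equilibrium \<Gamma> \<gamma> I" and "s \<in> I" and "t \<in> I"
  obtains g where "g \<in> SE2" and "\<gamma> s = act g (\<gamma> t)"
proof -
  have "orb SE2 (\<gamma> s) = orb SE2 (\<gamma> t)"
    using assms unfolding relative_equilibrium_def by (metis (mono_tags) imageI singletonD)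
  then have "\<gamma> s \<in> orb SE2 (\<gamma> t)" using mem_orb_SE2 by metis
  then show thesis using that by (auto simp: orb_def)
qed

lemma const_valueI:
  assumes "t \<in> I" and "\<And>s. s \<in> I \<Longrightarrow> f (\<gamma> s) = f (\<gamma> t)"
  shows "const_value f \<gamma> I = f (\<gamma> t)"
proof -
  have "(\<lambda>t. f (\<gamma> t)) ` I = (\<lambda>s. f (\<gamma> t)) ` I" by (rule image_cong[OF refl assms(2)])
  then have "(\<lambda>t. f (\<gamma> t)) ` I = {f (\<gamma> t)}" using assms(1) by blast
  then show ?thesis by (simp add: const_value_def)
qed

lemma const_value_hamiltonian:
  assumes "relative_equilibrium \<Gamma> \<gamma> I" and "t \<in> I"
  shows "const_value (hamiltonian \<Gamma>) \<gamma> I = hamiltonian \<Gamma> (\<gamma> t)"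
  by (rule const_valueI[OF assms(2)])
     (metis relative_equilibrium_imp_act[OF assms(1) _ assms(2)] hamiltonian_act)

text \<open>Without linear momentum, translations do not change the angular momentum.\<close>

lemma isotropy_fst_zero:
  assumes "fst \<mu> = 0"
  shows "isotropy \<mu> = SE2"
proof -
  have "coAd g \<mu> = \<mu>" if "g \<in> SE2" for g
  proof -
    obtain b u where g: "g = (b, u)" by fastforce
    obtain r where "\<mu> = (0, r)" using assms by (metis prod.collapse)
    then show ?thesis using coAd_eq[of b u 0 r] that by (simp add: g)
  qed
  then show ?thesis by (auto simp: isotropy_def)
qed

section \<open>Conservation of momentum\<close>

lemma vortex_field_components:
  "vortex_field \<Gamma> z $ 1 = - (1 / (2 * pi * \<i>)) *
     (\<Gamma> $ 2 / (cnj (z $ 1) - cnj (z $ 2)) + \<Gamma> $ 3 / (cnj (z $ 1) - cnj (z $ 3)))"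
  "vortex_field \<Gamma> z $ 2 = - (1 / (2 * pi * \<i>)) *
     (\<Gamma> $ 1 / (cnj (z $ 2) - cnj (z $ 1)) + \<Gamma> $ 3 / (cnj (z $ 2) - cnj (z $ 3)))"
  "vortex_field \<Gamma> z $ 3 = - (1 / (2 * pi * \<i>)) *
     (\<Gamma> $ 1 / (cnj (z $ 3) - cnj (z $ 1)) + \<Gamma> $ 2 / (cnj (z $ 3) - cnj (z $ 2)))"
proof -
  have others: "UNIV - {1} = {2, 3 :: 3}" "UNIV - {2} = {1, 3 :: 3}" "UNIV - {3} = {1, 2 :: 3}"
    unfolding UNIV_3 by auto
  have pair: "sum f {k, l} = f k + f l" if "k \<noteq> l" for f :: "3 \<Rightarrow> complex" and k l
    using that by simp
  have ne: "(2 :: 3) \<noteq> 3" "(1 :: 3) \<noteq> 3" "(1 :: 3) \<noteq> 2" by simp_all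
  show "vortex_field \<Gamma> z $ 1 = - (1 / (2 * pi * \<i>)) *
     (\<Gamma> $ 2 / (cnj (z $ 1) - cnj (z $ 2)) + \<Gamma> $ 3 / (cnj (z $ 1) - cnj (z $ 3)))"
    and "vortex_field \<Gamma> z $ 2 = - (1 / (2 * pi * \<i>)) *
     (\<Gamma> $ 1 / (cnj (z $ 2) - cnj (z $ 1)) + \<Gamma> $ 3 / (cnj (z $ 2) - cnj (z $ 3)))"
    and "vortex_field \<Gamma> z $ 3 = - (1 / (2 * pi * \<i>)) *
     (\<Gamma> $ 1 / (cnj (z $ 3) - cnj (z $ 1)) + \<Gamma> $ 2 / (cnj (z $ 3) - cnj (z $ 2)))"
    unfolding vortex_field_def vec_lambda_beta others
    by (rule arg_cong[where f = "times _"], rule pair, rule ne)+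
qed

lemma phase_space_distinct:
  assumes "z \<in> phase_space"
  shows "z $ 1 \<noteq> z $ 2" and "z $ 1 \<noteq> z $ 3" and "z $ 2 \<noteq> z $ 3"
  using assms by (simp_all add: phase_space_def)

text \<open>The mutual influences of two vortices, weighted by their strengths, are opposite to each
  other, because \<open>1 / cnj (zk - zl)\<close> is antisymmetric.\<close>

lemma total_velocity_zero: "(\<Sum>k\<in>UNIV. \<Gamma> $ k * vortex_field \<Gamma> z $ k) = 0"
proof -
  have neg: "cnj (z $ 2) - cnj (z $ 1) = - (cnj (z $ 1) - cnj (z $ 2))"
    "cnj (z $ 3) - cnj (z $ 1) = - (cnj (z $ 1) - cnj (z $ 3))"
    "cnj (z $ 3) - cnj (z $ 2) = - (cnj (z $ 2) - cnj (z $ 3))"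
    by simp_all
  have cancel: "x * (\<kappa> * (y * p + w * q)) + y * (\<kappa> * (x * (- p) + w * r))
      + w * (\<kappa> * (x * (- q) + y * (- r))) = 0" for x y w \<kappa> p q r :: complex
    by algebra
  show ?thesis
    unfolding sum_3 vortex_field_components neg divide_inverse inverse_minus_eq by (rule cancel)
qed

text \<open>The sum is the real part of \<open>S = \<Sum>k. \<Gamma>k * cnj zk * vk\<close>. Each pair of vortices contributes
  \<open>\<Gamma>k * \<Gamma>l * (cnj zk - cnj zl) / (cnj zk - cnj zl) = \<Gamma>k * \<Gamma>l\<close> to \<open>S\<close>, up to the common factor
  \<open>- 1 / (2 * pi * \<i>)\<close>, so \<open>S\<close> is purely imaginary.\<close>

lemma angular_momentum_derivative_zero:
  assumes "z \<in> phase_space"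
  shows "(\<Sum>k\<in>UNIV. \<Gamma> $ k * (z $ k \<bullet> vortex_field \<Gamma> z $ k)) = 0"
proof -
  define \<kappa> where "\<kappa> = - (1 / (2 * pi * \<i>))"
  define S where "S = (\<Sum>k\<in>UNIV. \<Gamma> $ k * (cnj (z $ k) * vortex_field \<Gamma> z $ k))"
  have pairing: "p / (p - q) + q / (q - p) = 1" if "p \<noteq> q" for p q :: complex
    using that by (simp add: divide_simps) (simp add: algebra_simps)
  have regroup: "x * (p * (\<kappa> * (y / (p - q) + w / (p - r)))) + y * (q * (\<kappa> * (x / (q - p) + w / (q - r))))
      + w * (r * (\<kappa> * (x / (r - p) + y / (r - q))))
    = \<kappa> * (x * y * (p / (p - q) + q / (q - p)) + x * w * (p / (p - r) + r / (r - p))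
      + y * w * (q / (q - r) + r / (r - q)))" for x y w p q r :: complex
    unfolding divide_inverse by algebra
  have "S = \<kappa> * (\<Gamma> $ 1 * \<Gamma> $ 2 + \<Gamma> $ 1 * \<Gamma> $ 3 + \<Gamma> $ 2 * \<Gamma> $ 3)"
    unfolding S_def sum_3 vortex_field_components \<kappa>_def[symmetric] regroup
    using phase_space_distinct[OF assms] by (simp add: pairing)
  then have "S = \<kappa> * complex_of_real (\<Gamma> $ 1 * \<Gamma> $ 2 + \<Gamma> $ 1 * \<Gamma> $ 3 + \<Gamma> $ 2 * \<Gamma> $ 3)"
    by simp
  moreover have "Re (\<kappa> * complex_of_real c) = Re \<kappa> * c" for c by simp
  moreover have "Re \<kappa> = 0" by (simp add: \<kappa>_def Re_divide)
  ultimately have "Re S = 0" by (metis mult_zero_left)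
  moreover have "Re S = (\<Sum>k\<in>UNIV. \<Gamma> $ k * (z $ k \<bullet> vortex_field \<Gamma> z $ k))"
    by (simp add: S_def inner_complex_def)
  ultimately show ?thesis by simp
qed

lemma momentum_conserved:
  assumes "trajectory \<Gamma> \<gamma> I" and "s \<in> I" and "t \<in> I"
  shows "momentum \<Gamma> (\<gamma> s) = momentum \<Gamma> (\<gamma> t)"
proof -
  have conv: "convex I" using assms(1) by (simp add: trajectory_def is_interval_convex)
  have comp: "((\<lambda>t. \<gamma> t $ k) has_vector_derivative vortex_field \<Gamma> (\<gamma> t) $ k) (at t within I)"
    if "t \<in> I" for k t
    using assms(1) that
    by (intro bounded_linear.has_vector_derivative[OF bounded_linear_vec_nth])
       (simp add: trajectory_def has_vector_derivative_at_within)
  have "((\<lambda>t. \<i> * (\<Sum>k\<in>UNIV. \<Gamma> $ k * \<gamma> t $ k)) has_vector_derivative 0) (at t within I)"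
    if "t \<in> I" for t
  proof -
    have "((\<lambda>t. \<i> * (\<Sum>k\<in>UNIV. \<Gamma> $ k * \<gamma> t $ k)) has_vector_derivative
        \<i> * (\<Sum>k\<in>UNIV. \<Gamma> $ k * vortex_field \<Gamma> (\<gamma> t) $ k)) (at t within I)"
      by (intro has_vector_derivative_mult_right has_vector_derivative_sum comp that)
    then show ?thesis by (simp add: total_velocity_zero)
  qed
  then have 1: "\<i> * (\<Sum>k\<in>UNIV. \<Gamma> $ k * \<gamma> s $ k) = \<i> * (\<Sum>k\<in>UNIV. \<Gamma> $ k * \<gamma> t $ k)"
    using has_vector_derivative_zero_constant[OF conv] assms(2,3) by (metis (no_types, lifting))
  have "((\<lambda>t. \<Sum>k\<in>UNIV. \<Gamma> $ k * ((\<gamma> t $ k \<bullet> \<gamma> t $ k) / 2)) has_vector_derivative 0) (at t within I)"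
    if "t \<in> I" for t
  proof -
    have "((\<lambda>t. \<gamma> t $ k \<bullet> \<gamma> t $ k) has_vector_derivative
        (\<gamma> t $ k \<bullet> vortex_field \<Gamma> (\<gamma> t) $ k + vortex_field \<Gamma> (\<gamma> t) $ k \<bullet> \<gamma> t $ k)) (at t within I)" for k
      by (intro bounded_bilinear.has_vector_derivative[OF bounded_bilinear_inner] comp that)
    then have "((\<lambda>t. \<Gamma> $ k / 2 * (\<gamma> t $ k \<bullet> \<gamma> t $ k)) has_vector_derivative
        \<Gamma> $ k / 2 * (\<gamma> t $ k \<bullet> vortex_field \<Gamma> (\<gamma> t) $ k + vortex_field \<Gamma> (\<gamma> t) $ k \<bullet> \<gamma> t $ k))
        (at t within I)" for k
      by (rule has_vector_derivative_mult_right)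
    then have "((\<lambda>t. \<Gamma> $ k * ((\<gamma> t $ k \<bullet> \<gamma> t $ k) / 2)) has_vector_derivative
        \<Gamma> $ k * (\<gamma> t $ k \<bullet> vortex_field \<Gamma> (\<gamma> t) $ k)) (at t within I)" for k
      by (simp add: inner_commute)
    then have "((\<lambda>t. \<Sum>k\<in>UNIV. \<Gamma> $ k * ((\<gamma> t $ k \<bullet> \<gamma> t $ k) / 2)) has_vector_derivative
        (\<Sum>k\<in>UNIV. \<Gamma> $ k * (\<gamma> t $ k \<bullet> vortex_field \<Gamma> (\<gamma> t) $ k))) (at t within I)"
      by (intro has_vector_derivative_sum)
    moreover have "\<gamma> t \<in> phase_space" using assms(1) that by (simp add: trajectory_def)
    ultimately show ?thesis by (simp add: angular_momentum_derivative_zero)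
  qed
  then have "(\<Sum>k\<in>UNIV. \<Gamma> $ k * ((\<gamma> s $ k \<bullet> \<gamma> s $ k) / 2))
      = (\<Sum>k\<in>UNIV. \<Gamma> $ k * ((\<gamma> t $ k \<bullet> \<gamma> t $ k) / 2))"
    using has_vector_derivative_zero_constant[OF conv] assms(2,3) by (metis (no_types, lifting))
  with 1 show ?thesis by (simp only: momentum_def power2_norm_eq_inner)
qed

section \<open>Relative equilibria with nonzero linear momentum\<close>

text \<open>A rotation by \<open>u \<noteq> 1\<close> would turn the nonzero linear momentum, which is constant in time.
  So a point of the curve can only be carried to another one by a translation, and the
  differences \<open>\<gamma> t $ k - \<gamma> t $ l\<close> do not depend on \<open>t\<close>.\<close>

lemma translating_relative_equilibrium:
  assumes "relative_equilibrium \<Gamma> \<gamma> I" and "(\<Sum>k\<in>UNIV. \<Gamma> $ k) = 0"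
    and "t \<in> I" and "fst (momentum \<Gamma> (\<gamma> t)) \<noteq> 0"
  shows "vortex_field \<Gamma> (\<gamma> t) $ k = vortex_field \<Gamma> (\<gamma> t) $ l"
proof -
  have traj: "trajectory \<Gamma> \<gamma> I" using assms(1) by (simp add: relative_equilibrium_def)
  have rigid: "\<gamma> t $ k - \<gamma> t $ l = \<gamma> s $ k - \<gamma> s $ l" if s: "s \<in> I" for s
  proof -
    obtain g where g: "g \<in> SE2" "\<gamma> s = act g (\<gamma> t)"
      using relative_equilibrium_imp_act[OF assms(1) s assms(3)] .
    obtain b u where bu: "g = (b, u)" by fastforce
    obtain m r where m: "momentum \<Gamma> (\<gamma> t) = (m, r)" by fastforce
    have "coAd g (m, r) = (m, r)"
      using momentum_equivariant[OF g(1) assms(2), of "\<gamma> t"] momentum_conserved[OF traj s assms(3)]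
      by (simp add: g(2) m)
    then have "u * m = m" using coAd_eq[of b u m r] g(1) by (simp add: bu)
    then have "u = 1" using assms(4) by (simp add: m)
    then show ?thesis by (simp add: g(2) bu act_component)
  qed
  have op: "open I" using traj by (simp add: trajectory_def)
  have "(\<gamma> has_vector_derivative vortex_field \<Gamma> (\<gamma> t)) (at t)"
    using traj assms(3) by (simp add: trajectory_def)
  then have "((\<lambda>s. \<gamma> s $ k - \<gamma> s $ l) has_vector_derivative
      vortex_field \<Gamma> (\<gamma> t) $ k - vortex_field \<Gamma> (\<gamma> t) $ l) (at t)"
    by (intro has_vector_derivative_diff bounded_linear.has_vector_derivative[OF bounded_linear_vec_nth])
  moreover have "((\<lambda>s. \<gamma> s $ k - \<gamma> s $ l) has_vector_derivative 0) (at t)"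
    by (rule has_vector_derivative_transform_within_open[OF has_vector_derivative_const op assms(3) rigid])
  ultimately show ?thesis using vector_derivative_unique_at by fastforce
qed

section \<open>Vorticities 1, 1 and -2\<close>

lemma vector_1_1_m2:
  fixes \<Gamma> :: "real^3"
  assumes "\<Gamma> = vector [1, 1, -2]"
  shows "\<Gamma> $ 1 = 1" and "\<Gamma> $ 2 = 1" and "\<Gamma> $ 3 = -2"
  using assms by (simp_all add: vector_3)

lemma exp_hamiltonian:
  assumes "\<Gamma> = vector [1, 1, -2]" and "z \<in> phase_space"
  shows "exp (2 * pi * hamiltonian \<Gamma> z)
    = (norm (z $ 1 - z $ 3))\<^sup>2 * (norm (z $ 2 - z $ 3))\<^sup>2 / norm (z $ 1 - z $ 2)"
proof -
  note pos = phase_space_distinct[OF assms(2)]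
  have *: "2 * pi * hamiltonian \<Gamma> z = 2 * ln (norm (z $ 1 - z $ 3)) + 2 * ln (norm (z $ 2 - z $ 3))
      - ln (norm (z $ 1 - z $ 2))"
    by (simp add: hamiltonian_def vector_1_1_m2[OF assms(1)])
  show ?thesis
    unfolding * using pos by (simp add: exp_diff exp_add exp_double)
qed

lemma fst_momentum:
  assumes "\<Gamma> = vector [1, 1, -2]"
  shows "fst (momentum \<Gamma> z) = \<i> * ((z $ 1 - z $ 3) + (z $ 2 - z $ 3))"
  by (simp add: momentum_def sum_3 vector_1_1_m2[OF assms] algebra_simps)

lemma fst_momentum_eq_0_iff:
  assumes "\<Gamma> = vector [1, 1, -2]"
  shows "fst (momentum \<Gamma> z) = 0 \<longleftrightarrow> z $ 2 - z $ 3 = - (z $ 1 - z $ 3)"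
  unfolding fst_momentum[OF assms] by (simp only: mult_eq_0_iff complex_i_not_zero simp_thms add_eq_0_iff)

lemma snd_momentum_collinear:
  assumes "\<Gamma> = vector [1, 1, -2]" and "fst (momentum \<Gamma> z) = 0"
  shows "snd (momentum \<Gamma> z) = (norm (z $ 1 - z $ 3))\<^sup>2"
proof -
  define a where "a = z $ 1 - z $ 3"
  have z1: "z $ 1 = z $ 3 + a" by (simp add: a_def)
  have z2: "z $ 2 = z $ 3 - a"
    using assms(2) unfolding fst_momentum_eq_0_iff[OF assms(1)] a_def by (simp add: algebra_simps)
  show ?thesis
    unfolding a_def[symmetric]
    by (simp add: momentum_def sum_3 vector_1_1_m2[OF assms(1)] z1 z2 power2_norm_eq_inner
        inner_add inner_diff inner_commute field_simps)
qed

text \<open>Two configurations with zero linear momentum are determined up to translation by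
  \<open>z1 - z3\<close>, and the common angular momentum makes these two vectors equally long; so their
  quotient is the rotation that carries one configuration to the other.\<close>

lemma collinear_orbit_eq_level_set:
  assumes "\<Gamma> = vector [1, 1, -2]" and "fst \<mu> = 0" and "z \<in> level_set \<Gamma> \<mu>"
  shows "orb SE2 z = level_set \<Gamma> \<mu>"
proof
  have sum0: "(\<Sum>k\<in>UNIV. \<Gamma> $ k) = 0" by (simp add: sum_3 vector_1_1_m2[OF assms(1)])
  have z: "z \<in> phase_space" "momentum \<Gamma> z = \<mu>" using assms(3) by (auto simp: level_set_def)
  show "orb SE2 z \<subseteq> level_set \<Gamma> \<mu>"
  proof
    fix w assume "w \<in> orb SE2 z"
    then obtain g where g: "g \<in> SE2" "w = act g z" by (auto simp: orb_def)
    have "g \<in> isotropy \<mu>" using g(1) isotropy_fst_zero[OF assms(2)] by simp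
    then have "momentum \<Gamma> w = \<mu>"
      using momentum_equivariant[OF g(1) sum0, of z] by (simp add: g(2) z(2) isotropy_def)
    then show "w \<in> level_set \<Gamma> \<mu>" using act_phase_space[OF g(1) z(1)] by (simp add: level_set_def g(2))
  qed
  show "level_set \<Gamma> \<mu> \<subseteq> orb SE2 z"
  proof
    fix w assume "w \<in> level_set \<Gamma> \<mu>"
    then have w: "w \<in> phase_space" "momentum \<Gamma> w = \<mu>" by (auto simp: level_set_def)
    have fz: "fst (momentum \<Gamma> z) = 0" and fw: "fst (momentum \<Gamma> w) = 0"
      using z w assms(2) by simp_all
    define u where "u = (w $ 1 - w $ 3) / (z $ 1 - z $ 3)"
    have zne: "z $ 1 - z $ 3 \<noteq> 0" using phase_space_distinct[OF z(1)] by simp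
    have "(norm (w $ 1 - w $ 3))\<^sup>2 = (norm (z $ 1 - z $ 3))\<^sup>2"
      using snd_momentum_collinear[OF assms(1) fz] snd_momentum_collinear[OF assms(1) fw] z w by simp
    then have "norm (w $ 1 - w $ 3) = norm (z $ 1 - z $ 3)" by simp
    then have nu: "norm u = 1" using zne by (simp add: u_def norm_divide)
    have e1: "w $ 1 - w $ 3 = u * (z $ 1 - z $ 3)" using zne by (simp add: u_def)
    have e2: "w $ 2 - w $ 3 = u * (z $ 2 - z $ 3)"
      using e1 fz fw unfolding fst_momentum_eq_0_iff[OF assms(1)] by (simp only: mult_minus_right)
    have "w $ k = u * z $ k + (w $ 3 - u * z $ 3)" for k
    proof -
      have *: "w $ 1 = u * z $ 1 + (w $ 3 - u * z $ 3)" using e1 by algebra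
      have "w $ 2 = u * z $ 2 + (w $ 3 - u * z $ 3)" using e2 by algebra
      moreover have "w $ 3 = u * z $ 3 + (w $ 3 - u * z $ 3)" by simp
      ultimately show ?thesis using * exhaust_3[of k] by metis
    qed
    then have "w = act (w $ 3 - u * z $ 3, u) z"
      unfolding vec_eq_iff act_component by blast
    moreover have "(w $ 3 - u * z $ 3, u) \<in> SE2" using nu by (simp add: SE2_def)
    ultimately show "w \<in> orb SE2 z" unfolding orb_def by (rule image_eqI)
  qed
qed

text \<open>With \<open>a = z1 - z3\<close> and \<open>b = z2 - z3\<close> the conclusion says \<open>a\<^sup>2 - a * b + b\<^sup>2 = 0\<close>, that is,
  \<open>a / b\<close> is a primitive sixth root of unity, so \<open>z1, z2, z3\<close> form an equilateral triangle.
  Up to conjugation, the difference of the two velocities is proportional to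
  \<open>1 / (a - b) - (1 / a - 1 / b)\<close>.\<close>

lemma equal_velocities_imp_equilateral:
  assumes "\<Gamma> = vector [1, 1, -2]" and "z \<in> phase_space"
    and "vortex_field \<Gamma> z $ 1 = vortex_field \<Gamma> z $ 2"
  shows "(z $ 1 - z $ 2)\<^sup>2 = - ((z $ 1 - z $ 3) * (z $ 2 - z $ 3))"
proof -
  define a where "a = z $ 1 - z $ 3"
  define b where "b = z $ 2 - z $ 3"
  define A where "A = cnj a"
  define B where "B = cnj b"
  have ne: "A \<noteq> 0" "B \<noteq> 0" "A - B \<noteq> 0"
    using phase_space_distinct[OF assms(2)] by (simp_all add: a_def b_def A_def B_def)
  have d: "cnj (z $ 1) - cnj (z $ 2) = A - B" "cnj (z $ 2) - cnj (z $ 1) = - (A - B)"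
    "cnj (z $ 1) - cnj (z $ 3) = A" "cnj (z $ 2) - cnj (z $ 3) = B"
    by (simp_all add: a_def b_def A_def B_def)
  have "1 / (A - B) - 2 / A = 1 / (- (A - B)) - 2 / B"
    using assms(3) by (simp only: vortex_field_components d vector_1_1_m2[OF assms(1)]) simp
  then have "1 / (A - B) = 1 / A - 1 / B"
    unfolding divide_minus_right by algebra
  also have "\<dots> = - ((A - B) / (A * B))" using ne by (simp add: field_simps)
  finally have "1 / (A - B) = - ((A - B) / (A * B))" .
  then have "(A - B)\<^sup>2 = - (A * B)" using ne by (simp add: field_simps power2_eq_square)
  then have "cnj ((a - b)\<^sup>2) = cnj (- (a * b))" by (simp add: A_def B_def)
  then have "(a - b)\<^sup>2 = - (a * b)" unfolding complex_cnj_cancel_iff .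
  moreover have "z $ 1 - z $ 2 = a - b" by (simp add: a_def b_def)
  ultimately show ?thesis by (simp only: a_def[symmetric] b_def[symmetric])
qed

text \<open>For side length \<open>s\<close> the left-hand side is \<open>(sqrt 3 * s) ^ 3\<close>, since \<open>a + b\<close> is twice the
  median of the triangle from \<open>z3\<close>, while the energy factor is \<open>s\<^sup>2 * s\<^sup>2 / s = s ^ 3\<close>.\<close>

lemma equilateral_norm_momentum:
  assumes "\<Gamma> = vector [1, 1, -2]" and "z \<in> phase_space"
    and "(z $ 1 - z $ 2)\<^sup>2 = - ((z $ 1 - z $ 3) * (z $ 2 - z $ 3))"
  shows "(norm (fst (momentum \<Gamma> z))) ^ 3 = 3 * sqrt 3 * exp (2 * pi * hamiltonian \<Gamma> z)"
proof -
  define a where "a = z $ 1 - z $ 3"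
  define b where "b = z $ 2 - z $ 3"
  have ab: "z $ 1 - z $ 2 = a - b" by (simp add: a_def b_def)
  have eq: "(a - b)\<^sup>2 = - (a * b)" using assms(3) unfolding ab a_def b_def .
  \<comment> \<open>\<open>a ^ 3 + b ^ 3\<close> is \<open>a + b\<close> times \<open>(a - b)\<^sup>2 + a * b = 0\<close>; norms then give \<open>\<bar>a\<bar> = \<bar>b\<bar>\<close>.\<close>
  have cub: "a ^ 3 = - (b ^ 3)" using eq by algebra
  have sum_sq: "(a + b)\<^sup>2 = 3 * (a * b)" using eq by algebra
  define s where "s = norm a"
  have spos: "s > 0" using phase_space_distinct[OF assms(2)] by (simp add: s_def a_def)
  have "s ^ 3 = norm b ^ 3" unfolding s_def by (metis cub norm_power norm_minus_cancel)
  then have nb: "norm b = s" using spos power_eq_imp_eq_base[of s 3 "norm b"] by simp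
  have "(norm (a - b))\<^sup>2 = s\<^sup>2"
    by (metis eq norm_power norm_minus_cancel norm_mult nb s_def power2_eq_square)
  then have nd: "norm (a - b) = s" using spos by (simp add: power2_eq_iff_nonneg)
  have "(norm (a + b))\<^sup>2 = 3 * s\<^sup>2"
    using arg_cong[OF sum_sq, of norm] by (simp add: norm_power norm_mult nb s_def power2_eq_square)
  also have "\<dots> = (sqrt 3 * s)\<^sup>2" by (simp add: power_mult_distrib)
  finally have "norm (a + b) = sqrt 3 * s"
    using spos by (subst (asm) power2_eq_iff_nonneg) auto
  then have "norm (fst (momentum \<Gamma> z)) = sqrt 3 * s"
    by (simp add: fst_momentum[OF assms(1)] norm_mult a_def b_def)
  moreover have "exp (2 * pi * hamiltonian \<Gamma> z) = s ^ 3"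
    unfolding exp_hamiltonian[OF assms(1,2)] ab a_def[symmetric] b_def[symmetric] nb nd s_def[symmetric]
    using spos by (simp add: power2_eq_square power3_eq_cube)
  ultimately show ?thesis by (simp add: power_mult_distrib power3_eq_cube[of "sqrt 3"])
qed

text \<open>The rational form of the energy makes its continuity off the collisions evident.\<close>

lemma openin_energy_superlevel:
  assumes "\<Gamma> = vector [1, 1, -2]"
  shows "openin (top_of_set phase_space) {z \<in> phase_space. exp (2 * pi * hamiltonian \<Gamma> z) > c}"
proof -
  define f where "f z = (norm (z $ 1 - z $ 3))\<^sup>2 * (norm (z $ 2 - z $ 3))\<^sup>2 / norm (z $ 1 - z $ 2)"
    for z :: "complex^3"
  have "continuous_on phase_space f"
    unfolding f_def by (intro continuous_intros) (auto dest: phase_space_distinct)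
  then have "openin (top_of_set phase_space) (phase_space \<inter> f -` {c<..})"
    by (rule continuous_openin_preimage_gen) simp
  moreover have "{z \<in> phase_space. exp (2 * pi * hamiltonian \<Gamma> z) > c} = phase_space \<inter> f -` {c<..}"
    using exp_hamiltonian[OF assms] by (auto simp: f_def)
  ultimately show ?thesis by simp
qed

text \<open>The reduced space has only one point.\<close>

lemma collinear_extremal:
  assumes "\<Gamma> = vector [1, 1, -2]" and "relative_equilibrium \<Gamma> \<gamma> I"
    and "fst (const_value (momentum \<Gamma>) \<gamma> I) = 0"
  shows "extremal \<Gamma> \<gamma> I"
proof -
  define \<mu> where "\<mu> = const_value (momentum \<Gamma>) \<gamma> I"
  have traj: "trajectory \<Gamma> \<gamma> I" using assms(2) by (simp add: relative_equilibrium_def)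
  have fst0: "fst \<mu> = 0" using assms(3) by (simp add: \<mu>_def)
  note orbit = collinear_orbit_eq_level_set[OF assms(1) fst0]
  have level: "\<gamma> t \<in> level_set \<Gamma> \<mu>" if t: "t \<in> I" for t
  proof -
    have "\<mu> = momentum \<Gamma> (\<gamma> t)"
      unfolding \<mu>_def by (rule const_valueI[OF t]) (rule momentum_conserved[OF traj _ t])
    then show ?thesis using traj t by (simp add: level_set_def trajectory_def)
  qed
  obtain t0 where t0: "t0 \<in> I" using traj by (auto simp: trajectory_def)
  have img: "orb SE2 ` level_set \<Gamma> \<mu> = {level_set \<Gamma> \<mu>}"
    using level[OF t0] orbit by auto
  let ?T = "orbit_topology SE2 (level_set \<Gamma> \<mu>)"
  have top: "topspace ?T = {level_set \<Gamma> \<mu>}" by (simp add: topspace_orbit_topology img)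
  have "local_extremum ?T (induced_hamiltonian \<Gamma>) (level_set \<Gamma> \<mu>)"
    unfolding local_extremum_def
    by (intro conjI exI[of _ "topspace ?T"] openin_topspace) (simp_all add: top)
  moreover have "(\<lambda>t. orb SE2 (\<gamma> t)) ` I = {level_set \<Gamma> \<mu>}"
    using level t0 orbit by auto
  ultimately show ?thesis
    unfolding extremal_def \<mu>_def[symmetric] Let_def isotropy_fst_zero[OF fst0] by blast
qed

text \<open>Nonzero linear momentum would make the triangle equilateral, where \<open>\<bar>\<Phi>\<^sub>C\<bar> ^ 3\<close> is tied to the
  energy. The radius of the disc is chosen so that its cube \<open>sqrt 3 * E\<close> is the value of
  \<open>3 * sqrt 3 * exp (2 * pi * h)\<close> at the energy bound \<open>exp (2 * pi * h) = E / 3\<close>.\<close>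

lemma small_momentum_imp_zero:
  assumes "\<Gamma> = vector [1, 1, -2]" and "relative_equilibrium \<Gamma> \<eta> J" and "t \<in> J"
    and "E / 3 < exp (2 * pi * hamiltonian \<Gamma> (\<eta> t))"
    and "norm (fst (momentum \<Gamma> (\<eta> t))) < root 3 (sqrt 3 * E)"
  shows "fst (momentum \<Gamma> (\<eta> t)) = 0"
proof (rule ccontr)
  assume ne: "fst (momentum \<Gamma> (\<eta> t)) \<noteq> 0"
  have ps: "\<eta> t \<in> phase_space"
    using assms(2,3) by (simp add: relative_equilibrium_def trajectory_def)
  have "(\<Sum>k\<in>UNIV. \<Gamma> $ k) = 0" by (simp add: sum_3 vector_1_1_m2[OF assms(1)])
  then have "vortex_field \<Gamma> (\<eta> t) $ 1 = vortex_field \<Gamma> (\<eta> t) $ 2"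
    using translating_relative_equilibrium assms(2,3) ne by blast
  then have *: "(norm (fst (momentum \<Gamma> (\<eta> t)))) ^ 3 = 3 * sqrt 3 * exp (2 * pi * hamiltonian \<Gamma> (\<eta> t))"
    using equilateral_norm_momentum equal_velocities_imp_equilateral assms(1) ps by blast
  have "(norm (fst (momentum \<Gamma> (\<eta> t)))) ^ 3 < (root 3 (sqrt 3 * E)) ^ 3"
    using assms(5) by (intro power_strict_mono) auto
  also have "\<dots> = sqrt 3 * E" by (simp add: odd_real_root_pow)
  finally have "sqrt 3 * (3 * exp (2 * pi * hamiltonian \<Gamma> (\<eta> t))) < sqrt 3 * E" using * by simp
  then show False using assms(4) by simp
qed

theorem proposition7:
  fixes \<Gamma> :: "real^3" and \<gamma> :: "real \<Rightarrow> complex^3" and I :: "real set"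
    and E :: real and \<mu> :: "complex \<times> real" and D :: "complex set"
    and U :: "(complex^3) set" and V :: "(complex \<times> real) set"
  assumes "\<Gamma> = vector [1, 1, -2]"
    and "relative_equilibrium \<Gamma> \<gamma> I"
    and "\<mu> = const_value (momentum \<Gamma>) \<gamma> I"
    and "fst \<mu> = 0"
    and "E = exp (2 * pi * const_value (hamiltonian \<Gamma>) \<gamma> I)"
    and "U = {z \<in> phase_space. exp (2 * pi * hamiltonian \<Gamma> z) > E / 3}"
    and "D = ball 0 (root 3 (sqrt 3 * E))"
    and "V = (D \<times> UNIV) - ({0} \<times> {0<..})"
  shows "(\<forall>t\<in>I. \<gamma> t $ 3 = midpoint (\<gamma> t $ 1) (\<gamma> t $ 2)) \<and>
    (openin (top_of_set phase_space) U \<and> \<gamma> ` I \<subseteq> U \<and> (\<forall>g\<in>SE2. act g ` U \<subseteq> U)) \<and>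
    (\<mu> \<in> interior (V \<union> {0} \<times> {0<..}) \<and> \<mu> \<notin> V) \<and>
    extremal \<Gamma> \<gamma> I \<and>
    \<not> (\<exists>\<eta> J t. relative_equilibrium \<Gamma> \<eta> J \<and> t \<in> J \<and> \<eta> t \<in> momentum \<Gamma> -` V \<inter> U)"
proof -
  have traj: "trajectory \<Gamma> \<gamma> I" using assms(2) by (simp add: relative_equilibrium_def)
  have ps: "\<gamma> t \<in> phase_space" if "t \<in> I" for t using traj that by (simp add: trajectory_def)
  have mom: "momentum \<Gamma> (\<gamma> t) = \<mu>" if t: "t \<in> I" for t
    unfolding assms(3)
    by (rule const_valueI[OF t, symmetric]) (rule momentum_conserved[OF traj _ t])
  have Epos: "E > 0" using assms(5) by simp
  have snd_pos: "snd (momentum \<Gamma> z) > 0" if "z \<in> phase_space" "fst (momentum \<Gamma> z) = 0" for z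
    using snd_momentum_collinear[OF assms(1) that(2)] phase_space_distinct[OF that(1)] by simp
  have mid: "\<gamma> t $ 3 = midpoint (\<gamma> t $ 1) (\<gamma> t $ 2)" if t: "t \<in> I" for t
  proof -
    have "\<gamma> t $ 2 - \<gamma> t $ 3 = - (\<gamma> t $ 1 - \<gamma> t $ 3)"
      using mom[OF t] assms(4) fst_momentum_eq_0_iff[OF assms(1), of "\<gamma> t"] by simp
    then have "\<gamma> t $ 1 + \<gamma> t $ 2 = \<gamma> t $ 3 + \<gamma> t $ 3" by algebra
    then show ?thesis by (simp add: midpoint_def scaleR_conv_of_real)
  qed
  have U_open: "openin (top_of_set phase_space) U"
    unfolding assms(6) by (rule openin_energy_superlevel[OF assms(1)])
  have U_curve: "\<gamma> ` I \<subseteq> U"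
    using ps Epos const_value_hamiltonian[OF assms(2)] by (auto simp: assms(5,6))
  have U_inv: "\<forall>g\<in>SE2. act g ` U \<subseteq> U"
    by (auto simp: assms(6) act_phase_space hamiltonian_act)
  \<comment> \<open>Putting the half line back into \<open>V\<close> gives the open cylinder, because its axis lies over \<open>0 \<in> D\<close>.\<close>
  have "0 \<in> D" using Epos by (simp add: assms(7))
  then have "V \<union> {0} \<times> {0<..} = D \<times> UNIV" by (auto simp: assms(8))
  moreover have "open (D \<times> (UNIV :: real set))" by (intro open_Times) (simp_all add: assms(7))
  ultimately have mu_int: "\<mu> \<in> interior (V \<union> {0} \<times> {0<..})"
    using \<open>0 \<in> D\<close> assms(4) by (simp add: interior_open mem_Times_iff)
  obtain t0 where "t0 \<in> I" using traj by (auto simp: trajectory_def)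
  then have "snd \<mu> > 0" using snd_pos[OF ps] mom assms(4) by auto
  then have mu_V: "\<mu> \<notin> V" using assms(4) by (auto simp: assms(8) mem_Times_iff)
  have "False" if eta: "relative_equilibrium \<Gamma> \<eta> J" "t \<in> J" "\<eta> t \<in> momentum \<Gamma> -` V \<inter> U" for \<eta> J t
  proof -
    have "norm (fst (momentum \<Gamma> (\<eta> t))) < root 3 (sqrt 3 * E)"
      and notin: "momentum \<Gamma> (\<eta> t) \<notin> {0} \<times> {0<..}"
      using eta(3) by (auto simp: assms(7,8) mem_Times_iff)
    then have "fst (momentum \<Gamma> (\<eta> t)) = 0"
      using small_momentum_imp_zero[OF assms(1) eta(1,2), of E] eta(3) assms(6) by auto
    moreover have "\<eta> t \<in> phase_space" using eta(3) assms(6) by simp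
    ultimately show False using snd_pos notin by (auto simp: mem_Times_iff)
  qed
  moreover have "extremal \<Gamma> \<gamma> I"
    using collinear_extremal[OF assms(1,2)] assms(3,4) by simp
  ultimately show ?thesis using mid U_open U_curve U_inv mu_int mu_V by blast
qed

end
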